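(* Let $(Q,+)$ be a group, $\varphi,\psi\in Aut(Q,+)$, $c\in Q$, and let $(Q,A)$ be the linear quasigroup $A(x,y)=\varphi x+\psi y+c$. Then the following equivalences hold: 1. $A\bot A^{(12)}$ if and only if for every $t\in Q$ the map $(-J_t\varphi^{-1}\psi+\psi^{-1}\varphi)$ is a permutation of $Q$; 2. $A\bot A^{(13)}$ if and only if the map $(\varphi J_{I\varphi^{-1}c}+\varepsilon)$ is a permutation of $Q$; 3. $A\bot A^{(23)}$ if and only if the map $(\varepsilon+\psi)$ is a permutation of $Q$; 4. $A\bot A^{(123)}$ if and only if the map $(\varphi J^{-1}_{\psi^{-1}c}+\psi^2)$ is a permutation of $Q$; 5. $A\bot A^{(132)}$ if and only if the map $(\varphi^2+\psi)$ is a permutation of $Q$.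
   Context: Groups are written additively but need not be commutative. Products of maps are compositions; sums of maps are pointwise in the written order: $(f+g)x=fx+gx$, $(-f+g)x=-(fx)+gx$. A permutation of $Q$ is a bijection $Q\to Q$; $\varepsilon$ is the identity map; $Ix=-x$; $J_tx=t+x-t$ for $t\in Q$. The parastrophes of a quasigroup $(Q,A)$ are the quasigroup operations defined by: $A(x_1,x_2)=x_3\Leftrightarrow A^{(12)}(x_2,x_1)=x_3\Leftrightarrow A^{(13)}(x_3,x_2)=x_1\Leftrightarrow A^{(23)}(x_1,x_3)=x_2\Leftrightarrow A^{(123)}(x_2,x_3)=x_1\Leftrightarrow A^{(132)}(x_3,x_1)=x_2$. For quasigroup operations $A,B$ on $Q$, $A\bot B$ ($A$ and $B$ are orthogonal) means that for all $a,b\in Q$ the system $A(x,y)=a$, $B(x,y)=b$ has a unique solution $(x,y)\in Q\times Q$. *)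

theory Defs
  imports Main "HOL-Library.Function_Algebras"
begin

text \<open>
  The group \<open>(Q,+)\<close> is a type of class \<^class>\<open>group_add\<close>, so the addition need not be commutative.
  Products of maps are \<open>\<circ>\<close>, powers of maps are \<open>^^\<close>, and sums and negatives of maps are the
  pointwise ones; note that \<open>\<circ>\<close> binds more weakly than \<open>+\<close>, so products need parentheses in sums.
\<close>

definition quasigroup :: "('a \<Rightarrow> 'a \<Rightarrow> 'a) \<Rightarrow> bool" where
  "quasigroup A \<longleftrightarrow> (\<forall>a b. (\<exists>!x. A x a = b) \<and> (\<exists>!y. A a y = b))"

definition par12 :: "('a \<Rightarrow> 'a \<Rightarrow> 'a) \<Rightarrow> 'a \<Rightarrow> 'a \<Rightarrow> 'a" where
  "par12 A x2 x1 = A x1 x2"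

definition par13 :: "('a \<Rightarrow> 'a \<Rightarrow> 'a) \<Rightarrow> 'a \<Rightarrow> 'a \<Rightarrow> 'a" where
  "par13 A x3 x2 = (THE x1. A x1 x2 = x3)"

definition par23 :: "('a \<Rightarrow> 'a \<Rightarrow> 'a) \<Rightarrow> 'a \<Rightarrow> 'a \<Rightarrow> 'a" where
  "par23 A x1 x3 = (THE x2. A x1 x2 = x3)"

definition par123 :: "('a \<Rightarrow> 'a \<Rightarrow> 'a) \<Rightarrow> 'a \<Rightarrow> 'a \<Rightarrow> 'a" where
  "par123 A x2 x3 = (THE x1. A x1 x2 = x3)"

definition par132 :: "('a \<Rightarrow> 'a \<Rightarrow> 'a) \<Rightarrow> 'a \<Rightarrow> 'a \<Rightarrow> 'a" where
  "par132 A x3 x1 = (THE x2. A x1 x2 = x3)"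

text \<open>
  The defining equivalences of the parastrophes; the definite descriptions above are meaningful
  because \<open>A\<close> is a quasigroup operation.
\<close>

lemma quasigroup_the_left:
  assumes "quasigroup A"
  shows "(THE x. A x a = b) = z \<longleftrightarrow> A z a = b"
proof -
  have "\<exists>!x. A x a = b" using assms by (simp add: quasigroup_def)
  from theI'[OF this] the1_equality[OF this] show ?thesis by blast
qed

lemma quasigroup_the_right:
  assumes "quasigroup A"
  shows "(THE y. A a y = b) = z \<longleftrightarrow> A a z = b"
proof -
  have "\<exists>!y. A a y = b" using assms by (simp add: quasigroup_def)
  from theI'[OF this] the1_equality[OF this] show ?thesis by blast
qed

lemma parastrophe_iff:
  assumes "quasigroup A"
  shows "par12 A x2 x1 = x3 \<longleftrightarrow> A x1 x2 = x3"
    and "par13 A x3 x2 = x1 \<longleftrightarrow> A x1 x2 = x3"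
    and "par23 A x1 x3 = x2 \<longleftrightarrow> A x1 x2 = x3"
    and "par123 A x2 x3 = x1 \<longleftrightarrow> A x1 x2 = x3"
    and "par132 A x3 x1 = x2 \<longleftrightarrow> A x1 x2 = x3"
  using assms
  by (simp_all add: par12_def par13_def par23_def par123_def par132_def
      quasigroup_the_left quasigroup_the_right)

lemma quasigroup_parastrophes:
  assumes "quasigroup A"
  shows "quasigroup (par12 A)" "quasigroup (par13 A)" "quasigroup (par23 A)"
    "quasigroup (par123 A)" "quasigroup (par132 A)"
proof -
  have ex: "\<exists>!x. A x a = b" "\<exists>!y. A a y = b" for a b
    using assms by (simp_all add: quasigroup_def)
  show "quasigroup (par12 A)" "quasigroup (par13 A)" "quasigroup (par23 A)"
    "quasigroup (par123 A)" "quasigroup (par132 A)"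
    using ex by (simp_all add: quasigroup_def parastrophe_iff[OF assms])
qed

definition orthogonal_ops :: "('a \<Rightarrow> 'a \<Rightarrow> 'a) \<Rightarrow> ('a \<Rightarrow> 'a \<Rightarrow> 'a) \<Rightarrow> bool"  (infix "\<bottom>" 50) where
  "A \<bottom> B \<longleftrightarrow> (\<forall>a b. \<exists>!(x, y). A x y = a \<and> B x y = b)"

definition automorphism :: "('a::group_add \<Rightarrow> 'a) \<Rightarrow> bool" where
  "automorphism f \<longleftrightarrow> bij f \<and> (\<forall>x y. f (x + y) = f x + f y)"

definition I :: "'a::group_add \<Rightarrow> 'a" where
  "I x = - x"

definition J :: "'a::group_add \<Rightarrow> 'a \<Rightarrow> 'a" where
  "J t x = t + x - t"

definition linear_op ::
  "('a::group_add \<Rightarrow> 'a) \<Rightarrow> ('a \<Rightarrow> 'a) \<Rightarrow> 'a \<Rightarrow> 'a \<Rightarrow> 'a \<Rightarrow> 'a" where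
  "linear_op \<phi> \<psi> c x y = \<phi> x + \<psi> y + c"

lemma quasigroup_linear_op:
  assumes "automorphism \<phi>" "automorphism \<psi>"
  shows "quasigroup (linear_op \<phi> \<psi> c)"
proof -
  have "bij \<phi>" "bij \<psi>" using assms by (simp_all add: automorphism_def)
  then have *: "\<exists>!x. \<phi> x = d" "\<exists>!y. \<psi> y = d" for d
    by (simp_all add: bij_iff)
  have left: "linear_op \<phi> \<psi> c x a = b \<longleftrightarrow> \<phi> x = b - c - \<psi> a" for x a b
    by (auto simp: linear_op_def eq_diff_eq)
  have right: "linear_op \<phi> \<psi> c a y = b \<longleftrightarrow> \<psi> y = - \<phi> a + (b - c)" for y a b
  proof -
    have "linear_op \<phi> \<psi> c a y = b \<longleftrightarrow> \<phi> a + \<psi> y = b - c"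
      by (simp add: linear_op_def eq_diff_eq)
    also have "\<dots> \<longleftrightarrow> \<psi> y = - \<phi> a + (b - c)"
      using add_left_cancel[of "\<phi> a" "\<psi> y" "- \<phi> a + (b - c)"] by (simp add: add.assoc[symmetric])
    finally show ?thesis .
  qed
  show ?thesis
    unfolding quasigroup_def
  proof (intro allI conjI)
    show "\<exists>!x. linear_op \<phi> \<psi> c x a = b" for a b
      unfolding left by (rule *)
    show "\<exists>!y. linear_op \<phi> \<psi> c a y = b" for a b
      unfolding right by (rule *)
  qed
qed

end

theory Submission
  imports Defs
begin

text \<open>
  Eliminating one unknown from the orthogonality system leaves an equation \<open>p x + d + q x = e\<close> with
  additive maps \<open>p\<close> and \<open>q\<close>. If \<open>p\<close> is an automorphism and \<open>q\<close> is an endomorphism, the substitution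
  of \<open>x + s\<close> for \<open>x\<close> replaces \<open>d\<close> by \<open>p s + d\<close>, so the constant \<open>d\<close> is irrelevant. This settles
  parts 2 to 5. In part 1, \<open>q\<close> reverses sums, and every value of \<open>d\<close> has to be kept.
\<close>

text \<open>Solving the second equation for \<open>x\<close> leaves \<open>A (g b y) y = a\<close>
  in the single unknown \<open>y\<close>. Unique solvability for every \<open>a\<close> is
  bijectivity of the left side as a map of \<open>y\<close>, while \<open>b\<close> survives as a
  parameter.\<close>

lemma orthogonal_ops_solve_left:
  assumes "\<And>x y b. B x y = b \<longleftrightarrow> x = g b y"
  shows "A \<bottom> B \<longleftrightarrow> (\<forall>b. bij (\<lambda>y. A (g b y) y))"
proof -
  have "(\<exists>!(x, y). A x y = a \<and> B x y = b) \<longleftrightarrow> (\<exists>!y. A (g b y) y = a)" for a b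
    unfolding assms by (simp add: Ex1_def) blast
  then show ?thesis
    unfolding orthogonal_ops_def bij_iff by (subst all_comm) simp
qed

lemma orthogonal_ops_solve_right:
  assumes "\<And>x y b. B x y = b \<longleftrightarrow> y = g b x"
  shows "A \<bottom> B \<longleftrightarrow> (\<forall>b. bij (\<lambda>x. A x (g b x)))"
proof -
  have "(\<exists>!(x, y). A x y = a \<and> B x y = b) \<longleftrightarrow> (\<exists>!x. A x (g b x) = a)" for a b
    unfolding assms by (simp add: Ex1_def) blast
  then show ?thesis
    unfolding orthogonal_ops_def bij_iff by (subst all_comm) simp
qed

lemma bij_comp_left_iff:
  assumes "bij g"
  shows "bij (\<lambda>x. g (h x)) \<longleftrightarrow> bij h"
proof
  assume "bij (\<lambda>x. g (h x))"
  then have "bij (inv g \<circ> (\<lambda>x. g (h x)))"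
    using assms by (intro bij_comp bij_imp_bij_inv)
  then show "bij h"
    using assms by (simp add: comp_def bij_is_inj)
next
  assume "bij h"
  then show "bij (\<lambda>x. g (h x))"
    using bij_comp[of h g] assms by (simp add: comp_def)
qed

lemma bij_comp_right_iff:
  assumes "bij g"
  shows "bij (\<lambda>x. h (g x)) \<longleftrightarrow> bij h"
proof
  assume "bij (\<lambda>x. h (g x))"
  then have "bij ((\<lambda>x. h (g x)) \<circ> inv g)"
    using assms by (intro bij_comp bij_imp_bij_inv)
  then show "bij h"
    using assms by (simp add: comp_def bij_is_surj surj_f_inv_f)
next
  assume "bij h"
  then show "bij (\<lambda>x. h (g x))"
    using bij_comp[of g h] assms by (simp add: comp_def)
qed

lemma bij_translation: "bij (\<lambda>x::'a::group_add. a + x + b)"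
  by (rule bij_betw_byWitness[where f' = "\<lambda>x. - a + x - b"]) (auto simp: algebra_simps)

text \<open>Strips constants at either end of a sum. Without commutativity it cannot reach a
  constant caught between two terms that depend on \<open>x\<close>.\<close>

lemma bij_translate_iff:
  "bij (\<lambda>x. a + h x + b) \<longleftrightarrow> bij h" for a b :: "'a::group_add"
  by (rule bij_comp_left_iff[OF bij_translation])

lemma automorphism_inv:
  assumes "automorphism f"
  shows "automorphism (inv f)"
proof -
  have "bij f" and add: "f (x + y) = f x + f y" for x y
    using assms by (simp_all add: automorphism_def)
  have "inv f (x + y) = inv f x + inv f y" for x y
    using \<open>bij f\<close> by (intro inv_f_eq) (simp_all add: add bij_is_inj bij_is_surj surj_f_inv_f)
  then show ?thesis
    using \<open>bij f\<close> by (simp add: automorphism_def bij_imp_bij_inv)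
qed

lemma automorphism_comp:
  assumes "automorphism f" "automorphism g"
  shows "automorphism (\<lambda>x. f (g x))"
  using assms bij_comp[of g f] by (simp add: automorphism_def comp_def)

lemma automorphism_minus:
  assumes "automorphism f"
  shows "f (- x) = - f x" and "f (x - y) = f x - f y"
proof -
  have add: "f (x + y) = f x + f y" for x y
    using assms by (simp add: automorphism_def)
  have "f 0 = 0"
    using add[of 0 0] add_left_cancel[of "f 0" "f 0" 0] by simp
  then have "f (- x) + f x = 0" for x
    using add[of "- x" x] by simp
  then have neg: "f (- x) = - f x" for x
    by (simp add: eq_neg_iff_add_eq_0)
  then show "f (- x) = - f x" and "f (x - y) = f x - f y"
    using add[of x "- y"] by simp_all
qed

lemma bij_sum_shift_iff:
  fixes p q :: "'a::group_add \<Rightarrow> 'a"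
  assumes p: "automorphism p" and q: "automorphism q"
  shows "bij (\<lambda>x. p x + d + q x) \<longleftrightarrow> bij (\<lambda>x. p x + q x)"
proof -
  have add: "p (x + y) = p x + p y" "q (x + y) = q x + q y" for x y
    using p q by (simp_all add: automorphism_def)
  \<comment> \<open>With this \<open>s\<close>, \<open>p (x + s) + d\<close> collapses to
    \<open>p x\<close>, and additivity of \<open>q\<close> pushes \<open>q s\<close> to the right
    end, where it can be stripped.\<close>
  obtain s where s: "p s = - d"
    using p by (metis automorphism_def bij_pointE)
  have "bij (\<lambda>x. p x + d + q x) \<longleftrightarrow> bij (\<lambda>x. p (0 + x + s) + d + q (0 + x + s))"
    by (rule bij_comp_right_iff[OF bij_translation, symmetric])
  also have "(\<lambda>x. p (0 + x + s) + d + q (0 + x + s)) = (\<lambda>x. 0 + (p x + q x) + q s)"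
    by (simp add: add s add.assoc)
  also have "bij \<dots> \<longleftrightarrow> bij (\<lambda>x. p x + q x)"
    by (rule bij_translate_iff)
  finally show ?thesis .
qed

text \<open>Conjugation by negation: negating the argument flips the signs of both
  \<open>x\<close>-terms, negating the value restores them and reverses the order of the summands.
  Only \<open>d\<close> changes sign.\<close>

lemma bij_diff_reverse:
  fixes p q :: "'a::group_add \<Rightarrow> 'a"
  assumes p: "automorphism p" and q: "automorphism q"
  shows "bij (\<lambda>x. p x + d - q x) \<longleftrightarrow> bij (\<lambda>x. - q x - d + p x)"
proof -
  have neg: "bij (uminus :: 'a \<Rightarrow> 'a)"
    by (rule bij_uminus)
  have "bij (\<lambda>x. p x + d - q x) \<longleftrightarrow> bij (\<lambda>x. - (p (- x) + d - q (- x)))"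
    using bij_comp_left_iff[OF neg, of "\<lambda>x. p (- x) + d - q (- x)"]
      bij_comp_right_iff[OF neg, of "\<lambda>x. p x + d - q x"] by simp
  also have "(\<lambda>x. - (p (- x) + d - q (- x))) = (\<lambda>x. - q x - d + p x)"
    by (simp add: automorphism_minus[OF p] automorphism_minus[OF q] minus_add add.assoc
        diff_conv_add_uminus del: add_uminus_conv_diff)
  finally show ?thesis .
qed

theorem theorem47:
  fixes \<phi> \<psi> :: "'a::group_add \<Rightarrow> 'a" and c :: 'a and A :: "'a \<Rightarrow> 'a \<Rightarrow> 'a"
  assumes "automorphism \<phi>" and "automorphism \<psi>"
    and "A = linear_op \<phi> \<psi> c"
  shows "(A \<bottom> par12 A \<longleftrightarrow> (\<forall>t. bij (- (J t \<circ> inv \<phi> \<circ> \<psi>) + (inv \<psi> \<circ> \<phi>)))) \<and>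
    (A \<bottom> par13 A \<longleftrightarrow> bij ((\<phi> \<circ> J (I (inv \<phi> c))) + id)) \<and>
    (A \<bottom> par23 A \<longleftrightarrow> bij (id + \<psi>)) \<and>
    (A \<bottom> par123 A \<longleftrightarrow> bij ((\<phi> \<circ> inv (J (inv \<psi> c))) + \<psi> ^^ 2)) \<and>
    (A \<bottom> par132 A \<longleftrightarrow> bij (\<phi> ^^ 2 + \<psi>))"
proof -
  note aut = assms(1,2)
  have A: "A x y = \<phi> x + \<psi> y + c" for x y
    by (simp add: assms(3) linear_op_def)
  have quasi: "quasigroup A"
    using quasigroup_linear_op[OF aut] assms(3) by simp
  note par_iff = parastrophe_iff[OF quasi]
  have bij: "bij \<phi>" "bij \<psi>"
    and add: "\<phi> (x + y) = \<phi> x + \<phi> y" "\<psi> (x + y) = \<psi> x + \<psi> y" for x y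
    using aut by (simp_all add: automorphism_def)
  have inv: "\<phi> (inv \<phi> x) = x" "\<psi> (inv \<psi> x) = x" "inv \<phi> (\<phi> x) = x" "inv \<psi> (\<psi> x) = x" for x
    using bij by (simp_all add: bij_is_inj bij_is_surj surj_f_inv_f)
  note minus = automorphism_minus[OF aut(1)] automorphism_minus[OF aut(2)]
    automorphism_minus[OF automorphism_inv[OF aut(1)]]
  have id_aut: "automorphism (\<lambda>x::'a. x)"
    by (simp add: automorphism_def bij_id[unfolded id_def])

  have part1: "A \<bottom> par12 A \<longleftrightarrow> (\<forall>t. bij (- (J t \<circ> inv \<phi> \<circ> \<psi>) + (inv \<psi> \<circ> \<phi>)))"
  proof -
    have aut': "automorphism (\<lambda>x. \<psi> (inv \<phi> (\<psi> x)))"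
      by (rule automorphism_comp[OF aut(2) automorphism_comp[OF automorphism_inv[OF aut(1)] aut(2)]])
    have "par12 A x y = b \<longleftrightarrow> y = inv \<phi> (b - c - \<psi> x)" for x y b
      unfolding par_iff A by (metis inv(1,3) add_diff_cancel diff_add_cancel)
    then have "A \<bottom> par12 A \<longleftrightarrow> (\<forall>b. bij (\<lambda>x. A x (inv \<phi> (b - c - \<psi> x))))"
      by (rule orthogonal_ops_solve_right)
    \<comment> \<open>Additivity splits the inner argument, and only the outer \<open>c\<close> can
      be stripped; \<open>0 +\<close> is padding for the shape required by
      \<open>bij_translate_iff\<close>.\<close>
    also have "\<dots> \<longleftrightarrow> (\<forall>b. bij (\<lambda>x. \<phi> x + \<psi> (inv \<phi> (b - c)) - \<psi> (inv \<phi> (\<psi> x))))"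
    proof -
      have "(\<lambda>x. A x (inv \<phi> (b - c - \<psi> x))) =
          (\<lambda>x. 0 + (\<phi> x + \<psi> (inv \<phi> (b - c)) - \<psi> (inv \<phi> (\<psi> x))) + c)" for b
        by (simp add: A minus(4,6) add_diff_eq)
      then show ?thesis by (simp only: bij_translate_iff)
    qed
    also have "\<dots> \<longleftrightarrow> (\<forall>t. bij (\<lambda>x. \<phi> x + \<psi> t - \<psi> (inv \<phi> (\<psi> x))))"
    proof -
      \<comment> \<open>As \<open>b\<close> runs through the group, so does
        \<open>inv \<phi> (b - c)\<close>; hence \<open>t\<close> may serve as the
        parameter.\<close>
      have "\<exists>b. inv \<phi> (b - c) = t" for t
        by (rule exI[of _ "\<phi> t + c"]) (simp add: inv)
      then show ?thesis by metis
    qed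
    also have "\<dots> \<longleftrightarrow> (\<forall>t. bij (\<lambda>x. - \<psi> (inv \<phi> (\<psi> x)) - \<psi> t + \<phi> x))"
      by (simp only: bij_diff_reverse[OF aut(1) aut'])
    also have "\<dots> \<longleftrightarrow> (\<forall>t. bij (- (J t \<circ> inv \<phi> \<circ> \<psi>) + (inv \<psi> \<circ> \<phi>)))"
    proof -
      \<comment> \<open>The conjugation \<open>J t\<close> encodes the inner constant:
        \<open>- t - J t u = - u - t\<close>. Applying \<open>\<psi>\<close> to this with
        \<open>u = inv \<phi> (\<psi> x)\<close>, followed by \<open>inv \<psi> (\<phi> x)\<close>,
        gives the left side.\<close>
      have "(\<lambda>x. - \<psi> (inv \<phi> (\<psi> x)) - \<psi> t + \<phi> x) =
          (\<lambda>x. \<psi> (- t + (- (J t \<circ> inv \<phi> \<circ> \<psi>) + (inv \<psi> \<circ> \<phi>)) x + 0))" for t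
        by (simp add: fun_eq_iff J_def minus add inv minus_add add.assoc
            diff_conv_add_uminus del: add_uminus_conv_diff)
      then have "bij (\<lambda>x. - \<psi> (inv \<phi> (\<psi> x)) - \<psi> t + \<phi> x) \<longleftrightarrow>
          bij (- (J t \<circ> inv \<phi> \<circ> \<psi>) + (inv \<psi> \<circ> \<phi>))" for t
        by (simp only: bij_comp_left_iff[OF bij(2)] bij_translate_iff)
      then show ?thesis by simp
    qed
    finally show ?thesis .
  qed

  have part2: "A \<bottom> par13 A \<longleftrightarrow> bij ((\<phi> \<circ> J (I (inv \<phi> c))) + id)"
  proof -
    have "par13 A x y = b \<longleftrightarrow> x = A b y" for x y b
      unfolding par_iff by auto
    then have "A \<bottom> par13 A \<longleftrightarrow> (\<forall>b. bij (\<lambda>y. A (A b y) y))"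
      by (rule orthogonal_ops_solve_left)
    \<comment> \<open>The parameter \<open>b\<close> enters only through the leading summand
      \<open>\<phi> (\<phi> b)\<close>, so the quantifier becomes vacuous once that summand is
      stripped.\<close>
    also have "\<dots> \<longleftrightarrow> bij (\<lambda>y. \<phi> (\<psi> y) + \<phi> c + \<psi> y)"
    proof -
      have "(\<lambda>y. A (A b y) y) = (\<lambda>y. \<phi> (\<phi> b) + (\<phi> (\<psi> y) + \<phi> c + \<psi> y) + c)" for b
        by (simp add: A add add.assoc)
      then show ?thesis by (simp only: bij_translate_iff) simp
    qed
    also have "\<dots> \<longleftrightarrow> bij (\<lambda>x. \<phi> x + \<phi> c + x)"
      by (rule bij_comp_right_iff[OF bij(2)])
    \<comment> \<open>Any inner constant may replace \<open>\<phi> c\<close>. The choice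
      \<open>c\<close> fits because \<open>\<phi>\<close> turns conjugation by
      \<open>- inv \<phi> c\<close> into \<open>- c + \<phi> x + c\<close>.\<close>
    also have "\<dots> \<longleftrightarrow> bij (\<lambda>x. \<phi> x + c + x)"
      by (simp only: bij_sum_shift_iff[OF aut(1) id_aut])
    also have "\<dots> \<longleftrightarrow> bij ((\<phi> \<circ> J (I (inv \<phi> c))) + id)"
    proof -
      have "(\<phi> \<circ> J (I (inv \<phi> c))) + id = (\<lambda>x. - c + (\<phi> x + c + x) + 0)"
        by (simp add: fun_eq_iff J_def I_def minus add inv add.assoc)
      then show ?thesis by (simp only: bij_translate_iff)
    qed
    finally show ?thesis .
  qed

  have part3: "A \<bottom> par23 A \<longleftrightarrow> bij (id + \<psi>)"
  proof -
    have "par23 A x y = b \<longleftrightarrow> y = A x b" for x y b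
      unfolding par_iff by auto
    then have "A \<bottom> par23 A \<longleftrightarrow> (\<forall>b. bij (\<lambda>x. A x (A x b)))"
      by (rule orthogonal_ops_solve_right)
    \<comment> \<open>The two terms in \<open>x\<close>, namely \<open>\<phi> x\<close> and
      \<open>\<psi> (\<phi> x)\<close>, are adjacent, so all constants stand at the right
      end.\<close>
    also have "\<dots> \<longleftrightarrow> bij (\<lambda>x. (id + \<psi>) (\<phi> x))"
    proof -
      have "(\<lambda>x. A x (A x b)) = (\<lambda>x. 0 + (id + \<psi>) (\<phi> x) + (\<psi> (\<psi> b) + \<psi> c + c))" for b
        by (simp add: A add add.assoc)
      then show ?thesis by (simp only: bij_translate_iff) simp
    qed
    also have "\<dots> \<longleftrightarrow> bij (id + \<psi>)"
      by (rule bij_comp_right_iff[OF bij(1)])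
    finally show ?thesis .
  qed

  have part4: "A \<bottom> par123 A \<longleftrightarrow> bij ((\<phi> \<circ> inv (J (inv \<psi> c))) + \<psi> ^^ 2)"
  proof -
    note shift = bij_sum_shift_iff[OF aut(1) automorphism_comp[OF aut(2) aut(2)]]
    have "par123 A x y = b \<longleftrightarrow> y = A b x" for x y b
      unfolding par_iff by auto
    then have "A \<bottom> par123 A \<longleftrightarrow> (\<forall>b. bij (\<lambda>x. A x (A b x)))"
      by (rule orthogonal_ops_solve_right)
    \<comment> \<open>Here \<open>b\<close> also sits between the two terms in \<open>x\<close>, as
      \<open>\<psi> (\<phi> b)\<close>; \<open>shift\<close> removes it and thereby the dependence
      on \<open>b\<close>.\<close>
    also have "\<dots> \<longleftrightarrow> bij (\<lambda>x. \<phi> x + \<psi> (\<psi> x))"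
    proof -
      have "(\<lambda>x. A x (A b x)) = (\<lambda>x. 0 + (\<phi> x + \<psi> (\<phi> b) + \<psi> (\<psi> x)) + (\<psi> c + c))" for b
        by (simp add: A add add.assoc)
      then show ?thesis by (simp only: bij_translate_iff shift) simp
    qed
    \<comment> \<open>An inner constant is put back on purpose: up to the leading
      \<open>- \<phi> (inv \<psi> c)\<close>, it is what the inverse conjugation
      \<open>J (- inv \<psi> c)\<close> contributes under \<open>\<phi>\<close>.\<close>
    also have "\<dots> \<longleftrightarrow> bij (\<lambda>x. \<phi> x + \<phi> (inv \<psi> c) + \<psi> (\<psi> x))"
      by (rule shift[symmetric])
    also have "\<dots> \<longleftrightarrow> bij ((\<phi> \<circ> inv (J (inv \<psi> c))) + \<psi> ^^ 2)"
    proof -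
      have "inv (J t) = J (- t)" for t :: 'a
        by (rule inv_unique_comp) (simp_all add: fun_eq_iff J_def algebra_simps)
      then have "(\<phi> \<circ> inv (J (inv \<psi> c))) + \<psi> ^^ 2 =
          (\<lambda>x. - \<phi> (inv \<psi> c) + (\<phi> x + \<phi> (inv \<psi> c) + \<psi> (\<psi> x)) + 0)"
        by (simp add: fun_eq_iff J_def minus add add.assoc numeral_2_eq_2)
      then show ?thesis by (simp only: bij_translate_iff)
    qed
    finally show ?thesis .
  qed

  have part5: "A \<bottom> par132 A \<longleftrightarrow> bij (\<phi> ^^ 2 + \<psi>)"
  proof -
    note shift = bij_sum_shift_iff[OF automorphism_comp[OF aut(1) aut(1)] aut(2)]
    have "par132 A x y = b \<longleftrightarrow> x = A y b" for x y b
      unfolding par_iff by auto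
    then have "A \<bottom> par132 A \<longleftrightarrow> (\<forall>b. bij (\<lambda>y. A (A y b) y))"
      by (rule orthogonal_ops_solve_left)
    \<comment> \<open>Both \<open>b\<close> and the inner \<open>c\<close> are trapped in the middle
      constant \<open>\<phi> (\<psi> b + c)\<close>, which \<open>shift\<close> deletes as a
      whole.\<close>
    also have "\<dots> \<longleftrightarrow> bij (\<lambda>y. \<phi> (\<phi> y) + \<psi> y)"
    proof -
      have "(\<lambda>y. A (A y b) y) = (\<lambda>y. 0 + (\<phi> (\<phi> y) + \<phi> (\<psi> b + c) + \<psi> y) + c)" for b
        by (simp add: A add add.assoc)
      then show ?thesis by (simp only: bij_translate_iff shift) simp
    qed
    also have "(\<lambda>y. \<phi> (\<phi> y) + \<psi> y) = \<phi> ^^ 2 + \<psi>"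
      by (simp add: fun_eq_iff numeral_2_eq_2)
    finally show ?thesis .
  qed

  show ?thesis
    using part1 part2 part3 part4 part5 by blast
qed

end
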